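(* There exists $C>0$ such that for all integers $N\ge 3$ and all primes $p$, $$\mathrm{Diam}\ \mathrm{Cay}(\mathrm{SL}_N(\mathbb{F}_p),\{\mathcal{A}_N,\mathcal{B}_N\})\ \le\ C N^3\log p.$$
   Context: $\mathcal{A}_N$ is the $N\times N$ matrix with $1$'s along the diagonal, $(1,2)$-entry equal to $1$, and all other entries $0$. $\mathcal{B}_N$ is the $N\times N$ matrix whose $(i,i+1)$-entries are $1$ for $1\le i\le N-1$, whose $(N,1)$-entry is $(-1)^{N-1}$, and whose other entries are all $0$. Both have determinant $1$ and are regarded as elements of $\mathrm{SL}_N(\mathbb{F}_p)$ by reducing entries modulo $p$. For a finite group $G$ with generating set $X$, $\mathrm{Diam}\ \mathrm{Cay}(G,X)$ is the diameter of the (undirected) Cayley graph, i.e. the least $d$ such that every element of $G$ is represented by a word of length at most $d$ in $X\cup X^{-1}$. *)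

theory Defs
  imports
    Complex_Main
    "HOL-Library.Extended_Real"
    "HOL-Algebra.Group"
    "HOL-Computational_Algebra.Primes"
    "Jordan_Normal_Form.Determinant"
begin

text \<open>
  The number of rows and the modulus are both quantified inside the theorem, so the field with
  \<open>p\<close> elements cannot be a type.  It is represented by the residues \<open>{0..<p}\<close> of type \<^typ>\<open>int\<close>,
  and a matrix over it by an integer matrix with entries in that range.
\<close>

definition mat_mod :: "nat \<Rightarrow> int mat \<Rightarrow> int mat" where
  "mat_mod p M = map_mat (\<lambda>x. x mod int p) M"

definition SL :: "nat \<Rightarrow> nat \<Rightarrow> int mat monoid" where
  "SL N p = \<lparr>carrier = {M \<in> carrier_mat N N. elements_mat M \<subseteq> {0..<int p} \<and> det M mod int p = 1},
     monoid.mult = (\<lambda>M M'. mat_mod p (M * M')),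
     one = 1\<^sub>m N\<rparr>"

text \<open>Indices of \<^typ>\<open>int mat\<close> start at \<open>0\<close>, so the \<open>(1,2)\<close>-entry is the one at \<open>(0,1)\<close>.\<close>

definition matA :: "nat \<Rightarrow> int mat" where
  "matA N = mat N N (\<lambda>(i, j). if i = j \<or> (i = 0 \<and> j = 1) then 1 else 0)"

definition matB :: "nat \<Rightarrow> int mat" where
  "matB N = mat N N (\<lambda>(i, j). if j = i + 1 then 1
     else if i = N - 1 \<and> j = 0 then (- 1) ^ (N - 1) else 0)"

definition word_value :: "('a, 'b) monoid_scheme \<Rightarrow> 'a list \<Rightarrow> 'a" where
  "word_value G w = foldr (\<lambda>x y. x \<otimes>\<^bsub>G\<^esub> y) w \<one>\<^bsub>G\<^esub>"

text \<open>
  The value is \<open>\<infinity>\<close> if no bound on the word length exists; for finite \<open>G\<close> this happens exactly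
  when \<open>X\<close> does not generate \<open>G\<close>.
\<close>

definition diam_Cay :: "('a, 'b) monoid_scheme \<Rightarrow> 'a set \<Rightarrow> enat" where
  "diam_Cay G X = Inf {enat d | d. \<forall>g\<in>carrier G. \<exists>w. set w \<subseteq> X \<union> m_inv G ` X \<and>
     length w \<le> d \<and> word_value G w = g}"

end

theory Submission imports Defs "HOL-Number_Theory.Cong" begin

text \<open>
  Write \<open>E\<^bsub>ij\<^esub>(t)\<close> for the elementary matrices, with indices from \<open>0\<close>; thus \<open>A = E\<^bsub>01\<^esub>(1)\<close>, and
  conjugation by \<open>B\<close> shifts both indices cyclically, up to sign. Conjugating \<open>E\<^bsub>N-1,0\<^esub>(1)\<close> by the
  product \<open>E\<^bsub>k,k+1\<^esub>(1) \<cdots> E\<^bsub>N-2,N-1\<^esub>(1)\<close>, which is a word of length \<open>O(N)\<close>, adds up all \<open>E\<^bsub>i0\<^esub>(1)\<close>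
  with \<open>i \<ge> k\<close>; quotients of consecutive such elements and cyclic shifts give every \<open>E\<^bsub>ij\<^esub>(1)\<close>
  with length \<open>O(N)\<close>.

  The hyperbolic matrix \<open>E\<^bsub>01\<^esub>(1) E\<^bsub>10\<^esub>(1)\<close> acts by conjugation on the matrices \<open>E\<^bsub>02\<^esub>(x) E\<^bsub>12\<^esub>(y)\<close>, and
  expanding a residue \<open>n\<close> along the exponentially growing entries of its powers produces some
  \<open>E\<^bsub>02\<^esub>(z) E\<^bsub>12\<^esub>(n)\<close> in \<open>O(log p)\<close> steps. Its commutator with \<open>E\<^bsub>01\<^esub>(1)\<close> is \<open>E\<^bsub>02\<^esub>(n)\<close>, whatever \<open>z\<close> is, and
  further commutators give every \<open>E\<^bsub>ij\<^esub>(t)\<close> with length \<open>O(N log p)\<close>. Gaussian elimination writes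
  an element of \<open>SL\<^sub>N(F\<^sub>p)\<close> with \<open>O(N\<^sup>2)\<close> such factors.
\<close>

subsection \<open>The special linear group modulo a prime\<close>

text \<open>By the Leibniz formula the determinant is a polynomial in the entries with integer
  coefficients.\<close>

lemma det_cong:
  fixes A B :: "int mat"
  assumes "A \<in> carrier_mat n n" "B \<in> carrier_mat n n"
    and "\<And>i j. i < n \<Longrightarrow> j < n \<Longrightarrow> [A $$ (i, j) = B $$ (i, j)] (mod m)"
  shows "[det A = det B] (mod m)"
  unfolding det_def'[OF assms(1)] det_def'[OF assms(2)]
proof (intro cong_sum cong_mult cong_prod cong_refl)
  fix \<pi> i assume "\<pi> \<in> {p. p permutes {0..<n}}" "i \<in> {0..<n}"
  then show "[A $$ (i, \<pi> i) = B $$ (i, \<pi> i)] (mod m)"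
    by (intro assms(3)) (auto dest: permutes_in_image[of \<pi> "{0..<n}" i])
qed

lemma mat_mod_carrier [simp]: "mat_mod p M \<in> carrier_mat n k \<longleftrightarrow> M \<in> carrier_mat n k"
  by (simp add: mat_mod_def)

lemma mat_mod_index:
  "i < dim_row M \<Longrightarrow> j < dim_col M \<Longrightarrow> mat_mod p M $$ (i, j) = M $$ (i, j) mod int p"
  by (simp add: mat_mod_def)

lemma dim_mat_mod [simp]: "dim_row (mat_mod p M) = dim_row M" "dim_col (mat_mod p M) = dim_col M"
  by (simp_all add: mat_mod_def)

lemma mat_mod_idem [simp]: "mat_mod p (mat_mod p M) = mat_mod p M"
  by (intro eq_matI) (auto simp: mat_mod_index)

lemma mat_mod_eqI:
  assumes "A \<in> carrier_mat n k" "B \<in> carrier_mat n k"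
    and "\<And>i j. i < n \<Longrightarrow> j < k \<Longrightarrow> [A $$ (i, j) = B $$ (i, j)] (mod int p)"
  shows "mat_mod p A = mat_mod p B"
  using assms by (intro eq_matI) (auto simp: mat_mod_index cong_def)

lemma mat_mod_mult:
  assumes "A \<in> carrier_mat n k" "B \<in> carrier_mat k l"
  shows "mat_mod p (mat_mod p A * mat_mod p B) = mat_mod p (A * B)"
proof (rule mat_mod_eqI[of _ n l])
  fix i j assume ij: "i < n" "j < l"
  have "[(\<Sum>r = 0..<k. (A $$ (i, r) mod p) * (B $$ (r, j) mod p)) =
         (\<Sum>r = 0..<k. A $$ (i, r) * B $$ (r, j))] (mod int p)"
    by (intro cong_sum cong_mult) (auto simp: cong_def)
  then show "[(mat_mod p A * mat_mod p B) $$ (i, j) = (A * B) $$ (i, j)] (mod int p)"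
    using ij assms by (simp add: scalar_prod_def mat_mod_index)
qed (use assms in auto)

lemma mat_mod_mult_left:
  assumes "A \<in> carrier_mat n k" "B \<in> carrier_mat k l"
  shows "mat_mod p (mat_mod p A * B) = mat_mod p (A * B)"
  using mat_mod_mult[of "mat_mod p A" n k B l p] mat_mod_mult[of A n k B l p] assms by simp

lemma mat_mod_mult_right:
  assumes "A \<in> carrier_mat n k" "B \<in> carrier_mat k l"
  shows "mat_mod p (A * mat_mod p B) = mat_mod p (A * B)"
  using mat_mod_mult[of A n k "mat_mod p B" l p] mat_mod_mult[of A n k B l p] assms by simp

lemma det_mat_mod:
  assumes "M \<in> carrier_mat n n"
  shows "[det (mat_mod p M) = det M] (mod int p)"
  by (rule det_cong[of _ n]) (use assms in \<open>auto simp: mat_mod_index\<close>)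

text \<open>Membership becomes a fixed-point equation for \<open>mat_mod p\<close> and a congruence,
  the forms in which products are easily handled.\<close>

lemma carrier_SL:
  assumes "prime p"
  shows "M \<in> carrier (SL N p) \<longleftrightarrow>
    M \<in> carrier_mat N N \<and> mat_mod p M = M \<and> [det M = 1] (mod int p)"
proof -
  have p: "1 < int p" using prime_gt_1_nat[OF assms] by simp
  have "elements_mat M \<subseteq> {0..<int p} \<longleftrightarrow> mat_mod p M = M" if M: "M \<in> carrier_mat N N"
  proof
    assume "elements_mat M \<subseteq> {0..<int p}"
    then show "mat_mod p M = M"
      using M elements_matI[of M N N] by (intro eq_matI) (auto simp: mat_mod_index subset_iff)
  next
    assume eq: "mat_mod p M = M"
    have "M $$ (i, j) \<in> {0..<int p}" if "i < N" "j < N" for i j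
    proof -
      have "M $$ (i, j) = M $$ (i, j) mod int p"
        using arg_cong[OF eq, of "\<lambda>X. X $$ (i, j)"] that M by (simp add: mat_mod_index)
      also have "\<dots> \<in> {0..<int p}" using p by simp
      finally show ?thesis .
    qed
    then show "elements_mat M \<subseteq> {0..<int p}" using M by (auto simp: elements_mat_def)
  qed
  then show ?thesis using p by (auto simp: SL_def cong_def)
qed

lemma mat_mod_in_SL:
  assumes "prime p" "M \<in> carrier_mat N N" "[det M = 1] (mod int p)"
  shows "mat_mod p M \<in> carrier (SL N p)"
  unfolding carrier_SL[OF assms(1)]
  using assms det_mat_mod[OF assms(2), of p] cong_trans by (auto simp: mat_mod_def)

lemma mult_SL: "M \<otimes>\<^bsub>SL N p\<^esub> M' = mat_mod p (M * M')"
  and one_SL: "\<one>\<^bsub>SL N p\<^esub> = 1\<^sub>m N"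
  by (simp_all add: SL_def)

lemma mat_mod_one: "prime p \<Longrightarrow> mat_mod p (1\<^sub>m N) = 1\<^sub>m N"
  using prime_gt_1_nat[of p] by (intro eq_matI) (auto simp: mat_mod_index)

lemma group_SL:
  assumes p: "prime p"
  shows "group (SL N p)"
proof (rule groupI)
  fix x y assume "x \<in> carrier (SL N p)" "y \<in> carrier (SL N p)"
  then show "x \<otimes>\<^bsub>SL N p\<^esub> y \<in> carrier (SL N p)"
    unfolding mult_SL carrier_SL[OF p]
    using cong_mult[of "det x" 1 _ "det y" 1] det_mat_mod[of "x * y" N p]
    by (auto simp: det_mult mat_mod_def intro: cong_trans)
next
  show "\<one>\<^bsub>SL N p\<^esub> \<in> carrier (SL N p)"
    by (simp add: one_SL carrier_SL[OF p] mat_mod_one[OF p])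
next
  fix x y z assume "x \<in> carrier (SL N p)" "y \<in> carrier (SL N p)" "z \<in> carrier (SL N p)"
  then have *: "x \<in> carrier_mat N N" "y \<in> carrier_mat N N" "z \<in> carrier_mat N N"
    by (auto simp: carrier_SL[OF p])
  then show "x \<otimes>\<^bsub>SL N p\<^esub> y \<otimes>\<^bsub>SL N p\<^esub> z = x \<otimes>\<^bsub>SL N p\<^esub> (y \<otimes>\<^bsub>SL N p\<^esub> z)"
    unfolding mult_SL using mat_mod_mult_left[of "x * y" N N z N p]
      mat_mod_mult_right[of x N N "y * z" N p] by (simp add: assoc_mult_mat[of _ N N _ N _ N])
next
  fix x assume "x \<in> carrier (SL N p)"
  then show "\<one>\<^bsub>SL N p\<^esub> \<otimes>\<^bsub>SL N p\<^esub> x = x"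
    by (auto simp: mult_SL one_SL carrier_SL[OF p])
next
  fix x assume x: "x \<in> carrier (SL N p)"
  then have xc: "x \<in> carrier_mat N N" and dx: "[det x = 1] (mod int p)"
    by (auto simp: carrier_SL[OF p])
  \<comment> \<open>The adjugate is an inverse up to the factor \<open>det x\<close>, which is 1
    modulo \<open>p\<close>; its reduction is the inverse sought.\<close>
  let ?a = "adj_mat x"
  have a: "?a \<in> carrier_mat N N" "?a * x = det x \<cdot>\<^sub>m 1\<^sub>m N" using adj_mat[OF xc] by auto
  have ax: "mat_mod p (?a * x) = 1\<^sub>m N"
  proof -
    have "mat_mod p (det x \<cdot>\<^sub>m 1\<^sub>m N) = mat_mod p (1\<^sub>m N)"
      by (rule mat_mod_eqI[of _ N N]) (use dx in auto)
    then show ?thesis by (simp add: a(2) mat_mod_one[OF p])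
  qed
  have "[det ?a * det x = 1] (mod int p)"
    using det_mat_mod[of "?a * x" N p] a(1) xc by (simp add: ax det_mult cong_sym)
  moreover have "[det ?a * det x = det ?a * 1] (mod int p)"
    by (intro cong_mult dx cong_refl)
  ultimately have "[det ?a = 1] (mod int p)"
    by (metis cong_sym cong_trans mult.right_neutral)
  then have "mat_mod p ?a \<in> carrier (SL N p)"
    by (intro mat_mod_in_SL p a)
  moreover have "mat_mod p ?a \<otimes>\<^bsub>SL N p\<^esub> x = \<one>\<^bsub>SL N p\<^esub>"
    unfolding mult_SL one_SL using mat_mod_mult_left[OF a(1) xc, of p] ax by simp
  ultimately show "\<exists>y\<in>carrier (SL N p). y \<otimes>\<^bsub>SL N p\<^esub> x = \<one>\<^bsub>SL N p\<^esub>" by blast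
qed

section \<open>Words over a set of generators and their inverses\<close>

context group begin

lemma word_value_closed:
  "set w \<subseteq> carrier G \<Longrightarrow> word_value G w \<in> carrier G"
  by (induction w) (auto simp: word_value_def)

lemma word_value_append:
  "set v \<subseteq> carrier G \<Longrightarrow> set w \<subseteq> carrier G \<Longrightarrow>
    word_value G (v @ w) = word_value G v \<otimes> word_value G w"
proof (induction v)
  case Nil
  then show ?case using word_value_closed[of w] by (simp add: word_value_def)
next
  case (Cons a v)
  have "word_value G (x # u) = x \<otimes> word_value G u" for x u by (simp add: word_value_def)
  then show ?case using Cons word_value_closed[of v] word_value_closed[of w]
    by (simp add: m_assoc)
qed

text \<open>Reverse the word and invert each letter; the alphabet is closed under inverses.\<close>

lemma word_value_inverse:
  assumes "X \<subseteq> carrier G" "set w \<subseteq> X \<union> m_inv G ` X"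
  shows "\<exists>v. set v \<subseteq> X \<union> m_inv G ` X \<and> length v = length w \<and>
    word_value G v = inv (word_value G w)"
  using assms(2)
proof (induction w)
  case Nil
  show ?case by (rule exI[of _ "[]"]) (simp add: word_value_def)
next
  case (Cons a w)
  let ?Y = "X \<union> m_inv G ` X"
  have Y: "?Y \<subseteq> carrier G" using assms(1) by auto
  obtain v where v: "set v \<subseteq> ?Y" "length v = length w" "word_value G v = inv (word_value G w)"
    using Cons by auto
  have a: "a \<in> carrier G" "inv a \<in> ?Y" using Cons.prems assms(1) by auto
  have w: "word_value G w \<in> carrier G" using Cons.prems Y by (intro word_value_closed) auto
  have one: "word_value G [b] = b" if "b \<in> carrier G" for b
    using that by (simp add: word_value_def)
  have "word_value G (v @ [inv a]) = inv (word_value G w) \<otimes> inv a"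
    using v Y a by (subst word_value_append) (auto simp: one)
  also have "\<dots> = inv (a \<otimes> word_value G w)" using a w by (simp add: inv_mult_group)
  finally show ?case
    using v a by (intro exI[of _ "v @ [inv a]"]) (auto simp: word_value_def)
qed

end

subsection \<open>Word length of integer matrices modulo a prime\<close>

locale sl_words =
  fixes N p :: nat
  assumes N: "3 \<le> N" and p: "prime p"
begin

sublocale SL: group "SL N p"
  by (rule group_SL[OF p])

abbreviation gens :: "int mat set" where
  "gens \<equiv> {mat_mod p (matA N), mat_mod p (matB N)}"

abbreviation elem :: "nat \<Rightarrow> nat \<Rightarrow> int \<Rightarrow> int mat" where
  "elem i j t \<equiv> addrow_mat N t i j"

lemma matA_elem: "matA N = elem 0 1 1"
  using N by (intro eq_matI) (auto simp: matA_def)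

lemma matA_carrier: "matA N \<in> carrier_mat N N" and matB_carrier: "matB N \<in> carrier_mat N N"
  by (auto simp: matA_def matB_def)

lemma elem_mult:
  "M \<in> carrier_mat N n \<Longrightarrow> j < N \<Longrightarrow> elem i j t * M = addrow t i j M"
  by (rule addrow_mat[symmetric])

lemma mult_elem:
  "M \<in> carrier_mat n N \<Longrightarrow> i < N \<Longrightarrow> M * elem i j t = addcol t j i M"
  by (rule addcol_mat[symmetric])

lemma matB_index:
  "i < N \<Longrightarrow> j < N \<Longrightarrow> matB N $$ (i, j) =
    (if j = i + 1 then 1 else if i = N - 1 \<and> j = 0 then (-1) ^ (N - 1) else 0)"
  by (simp add: matB_def)

text \<open>Row \<open>j\<close> and column \<open>i + 1\<close> of \<open>matB N\<close> are unit
  vectors, so both products add a single entry \<open>t\<close> at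
  \<open>(i, j + 1)\<close>.\<close>

lemma elem_matB:
  assumes "i + 1 < N" "j + 1 < N"
  shows "elem i j t * matB N = matB N * elem (i + 1) (j + 1) t"
  using assms matB_carrier
  by (subst elem_mult[of _ N], simp, simp, subst mult_elem[of _ N], simp, simp)
    (intro eq_matI, auto simp: matB_index)

text \<open>Column 0 of \<open>matB N\<close> carries the sign \<open>(-1) ^ (N - 1)\<close>, which
  therefore appears when row 0 wraps round to row \<open>N - 1\<close>.\<close>

lemma elem_matB_row_wrap:
  assumes "j + 1 < N"
  shows "elem (N - 1) j ((-1) ^ (N - 1) * t) * matB N = matB N * elem 0 (j + 1) t"
proof -
  have dims [simp]: "dim_row (matB N) = N" "dim_col (matB N) = N"
    using matB_carrier by auto
  have "addrow ((-1) ^ (N - 1) * t) (N - 1) j (matB N) = addcol t (j + 1) 0 (matB N)"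
  proof (intro eq_matI)
    fix a b assume "a < dim_row (addcol t (j + 1) 0 (matB N))" "b < dim_col (addcol t (j + 1) 0 (matB N))"
    then have ab: "a < N" "b < N" by auto
    consider "a = N - 1" "b = j + 1" | "a \<noteq> N - 1" | "a = N - 1" "b \<noteq> j + 1" by blast
    then show "addrow ((-1) ^ (N - 1) * t) (N - 1) j (matB N) $$ (a, b) =
        addcol t (j + 1) 0 (matB N) $$ (a, b)"
      by cases (use ab assms in \<open>auto simp: matB_index\<close>)
  qed auto
  then show ?thesis
    using assms matB_carrier by (simp add: elem_mult[of _ N] mult_elem[of _ N])
qed

lemma sign_square: "(-1) ^ k * ((-1) ^ k * t) = (t :: int)"
  by (simp add: mult.assoc[symmetric] power_mult_distrib[symmetric])

text \<open>Column 0 has a single nonzero entry, in the last row. Its sign cancels the cofactor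
  sign, and the minor is the identity.\<close>

lemma det_matB: "det (matB N) = 1"
proof -
  let ?D = "mat_delete (matB N) (N - 1) 0"
  have "det (matB N) = (\<Sum>i<N. matB N $$ (i, 0) * cofactor (matB N) i 0)"
    by (rule laplace_expansion_column[OF matB_carrier]) (use N in simp)
  also have "\<dots> = (\<Sum>i\<in>{N - 1}. matB N $$ (i, 0) * cofactor (matB N) i 0)"
    by (rule sum.mono_neutral_right) (use N in \<open>auto simp: matB_index\<close>)
  also have "\<dots> = (-1) ^ (N - 1) * ((-1) ^ (N - 1) * det ?D)"
    using N by (simp add: matB_index cofactor_def)
  also have "?D = 1\<^sub>m (N - 1)"
    using N by (intro eq_matI) (auto simp: mat_delete_def matB_def)
  finally show ?thesis by (simp add: sign_square)
qed

text \<open>\<open>M\<close> need not be reduced modulo \<open>p\<close>, so that matrix identities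
  can be proved over the integers and reduction enters only through the value of the word.\<close>

definition len_le :: "nat \<Rightarrow> int mat \<Rightarrow> bool" where
  "len_le d M \<longleftrightarrow> M \<in> carrier_mat N N \<and>
    (\<exists>w. set w \<subseteq> gens \<union> m_inv (SL N p) ` gens \<and> length w \<le> d \<and>
      word_value (SL N p) w = mat_mod p M)"

lemma gens_carrier: "gens \<subseteq> carrier (SL N p)"
  using N by (auto intro!: mat_mod_in_SL p matA_carrier matB_carrier
    simp: det_matB matA_elem det_addrow_mat)

lemma words_carrier: "gens \<union> m_inv (SL N p) ` gens \<subseteq> carrier (SL N p)"
  using gens_carrier by auto

lemma len_le_carrier: "len_le d M \<Longrightarrow> M \<in> carrier_mat N N"
  by (simp add: len_le_def)

lemma len_le_SL: "len_le d M \<Longrightarrow> mat_mod p M \<in> carrier (SL N p)"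
proof -
  assume "len_le d M"
  then obtain w where w: "set w \<subseteq> gens \<union> m_inv (SL N p) ` gens"
    "word_value (SL N p) w = mat_mod p M"
    unfolding len_le_def by blast
  have "word_value (SL N p) w \<in> carrier (SL N p)"
    by (rule SL.word_value_closed[OF subset_trans[OF w(1) words_carrier]])
  then show ?thesis by (simp only: w(2))
qed

lemma len_le_det: "len_le d M \<Longrightarrow> [det M = 1] (mod int p)"
  using len_le_SL[of d M] det_mat_mod[of M N p]
  by (auto simp: carrier_SL[OF p] len_le_carrier cong_def)

lemma len_le_mono: "len_le d M \<Longrightarrow> d \<le> e \<Longrightarrow> len_le e M"
  unfolding len_le_def using le_trans by blast

lemma len_le_cong:
  "len_le d M \<Longrightarrow> M' \<in> carrier_mat N N \<Longrightarrow> mat_mod p M = mat_mod p M' \<Longrightarrow> len_le d M'"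
  by (simp add: len_le_def)

lemma len_le_one: "len_le 0 (1\<^sub>m N)"
  by (auto simp: len_le_def word_value_def mat_mod_one[OF p] one_SL)

lemma len_le_gen: "M \<in> carrier_mat N N \<Longrightarrow> mat_mod p M \<in> gens \<Longrightarrow> len_le 1 M"
  using gens_carrier unfolding len_le_def
  by (intro conjI exI[of _ "[mat_mod p M]"]) (auto simp: word_value_def subset_iff)

lemma len_le_matA: "len_le 1 (matA N)" and len_le_matB: "len_le 1 (matB N)"
  by (rule len_le_gen; simp add: matA_carrier matB_carrier)+

lemma len_le_mult:
  assumes "len_le d M" "len_le e M'"
  shows "len_le (d + e) (M * M')"
proof -
  let ?Y = "gens \<union> m_inv (SL N p) ` gens"
  obtain v w where v: "set v \<subseteq> ?Y" "length v \<le> d" "word_value (SL N p) v = mat_mod p M"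
    and w: "set w \<subseteq> ?Y" "length w \<le> e" "word_value (SL N p) w = mat_mod p M'"
    using assms unfolding len_le_def by blast
  have M: "M \<in> carrier_mat N N" "M' \<in> carrier_mat N N"
    using assms by (auto simp: len_le_carrier)
  have "word_value (SL N p) (v @ w) = mat_mod p (M * M')"
    using SL.word_value_append[OF subset_trans[OF v(1) words_carrier]
        subset_trans[OF w(1) words_carrier]] v(3) w(3) mat_mod_mult[OF M, of p]
    by (simp add: mult_SL)
  then show ?thesis
    unfolding len_le_def using v w M by (intro conjI exI[of _ "v @ w"]) auto
qed

lemma len_le_inverse:
  assumes "len_le d M"
  obtains w where "set w \<subseteq> gens \<union> m_inv (SL N p) ` gens" "length w \<le> d"
    "word_value (SL N p) w = inv\<^bsub>SL N p\<^esub> mat_mod p M"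
proof -
  obtain v where v: "set v \<subseteq> gens \<union> m_inv (SL N p) ` gens" "length v \<le> d"
    "word_value (SL N p) v = mat_mod p M"
    using assms unfolding len_le_def by blast
  obtain w where "set w \<subseteq> gens \<union> m_inv (SL N p) ` gens" "length w = length v"
    "word_value (SL N p) w = inv\<^bsub>SL N p\<^esub> word_value (SL N p) v"
    using SL.word_value_inverse[OF gens_carrier v(1)] by blast
  then show ?thesis using v by (intro that[of w]) simp_all
qed

lemma len_le_inverse_matrix:
  assumes "len_le d M"
  obtains M' where "len_le d M'" "mat_mod p M' = inv\<^bsub>SL N p\<^esub> mat_mod p M"
proof -
  let ?M = "inv\<^bsub>SL N p\<^esub> mat_mod p M"
  have M: "?M \<in> carrier (SL N p)" using len_le_SL[OF assms] by simp
  then have "mat_mod p ?M = ?M" "?M \<in> carrier_mat N N" by (auto simp: carrier_SL[OF p])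
  moreover obtain w where "set w \<subseteq> gens \<union> m_inv (SL N p) ` gens" "length w \<le> d"
    "word_value (SL N p) w = ?M"
    using len_le_inverse[OF assms] .
  ultimately have "len_le d ?M" unfolding len_le_def by (intro conjI exI[of _ w]) simp_all
  then show ?thesis using that \<open>mat_mod p ?M = ?M\<close> by blast
qed

lemma det_cancel:
  assumes "M \<in> carrier_mat N N" "M' \<in> carrier_mat N N"
    and "[det M = 1] (mod int p)" "[det (M * M') = 1] (mod int p)"
  shows "[det M' = 1] (mod int p)"
proof -
  have "[det M * det M' = 1 * det M'] (mod int p)"
    by (intro cong_mult assms cong_refl)
  then show ?thesis using assms by (auto simp: det_mult cong_def)
qed

text \<open>Put a word for the inverse of \<open>M\<close> before one for \<open>M * X\<close>. With
  this form of inversion, conjugations and commutators can be stated as equations between products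
  of integer matrices.\<close>

lemma len_le_cancel_left:
  assumes M: "len_le d M" and MX: "len_le e (M * X)" and X: "X \<in> carrier_mat N N"
  shows "len_le (d + e) X"
proof -
  have Mc: "M \<in> carrier_mat N N" using M by (rule len_le_carrier)
  obtain M' where M': "len_le d M'" "mat_mod p M' = inv\<^bsub>SL N p\<^esub> mat_mod p M"
    using len_le_inverse_matrix[OF M] .
  \<comment> \<open>Cancellation takes place in the group, so the reduction of \<open>X\<close> must
    first be seen to lie in it.\<close>
  have "[det X = 1] (mod int p)"
    using det_cancel[OF Mc X len_le_det[OF M] len_le_det[OF MX]] .
  then have XS: "mat_mod p X \<in> carrier (SL N p)" by (intro mat_mod_in_SL p X)
  have "mat_mod p (M' * (M * X)) =
      mat_mod p M' \<otimes>\<^bsub>SL N p\<^esub> (mat_mod p M \<otimes>\<^bsub>SL N p\<^esub> mat_mod p X)"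
    using mat_mod_mult[OF Mc X, of p] mat_mod_mult[OF len_le_carrier[OF M'(1)] len_le_carrier[OF MX], of p]
    by (simp add: mult_SL)
  also have "\<dots> = mat_mod p X"
    using XS len_le_SL[OF M] by (simp add: M'(2) SL.inv_solve_left')
  finally show ?thesis
    using len_le_cong[OF len_le_mult[OF M'(1) MX] X] by simp
qed

lemma len_le_cancel_right:
  assumes M: "len_le d M" and XM: "len_le e (X * M)" and X: "X \<in> carrier_mat N N"
  shows "len_le (d + e) X"
proof -
  have Mc: "M \<in> carrier_mat N N" using M by (rule len_le_carrier)
  obtain M' where M': "len_le d M'" "mat_mod p M' = inv\<^bsub>SL N p\<^esub> mat_mod p M"
    using len_le_inverse_matrix[OF M] .
  have "[det X = 1] (mod int p)"
    using det_cancel[OF Mc X len_le_det[OF M]] len_le_det[OF XM] Mc X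
    by (simp add: det_mult mult.commute)
  then have XS: "mat_mod p X \<in> carrier (SL N p)" by (intro mat_mod_in_SL p X)
  have "mat_mod p ((X * M) * M') =
      (mat_mod p X \<otimes>\<^bsub>SL N p\<^esub> mat_mod p M) \<otimes>\<^bsub>SL N p\<^esub> mat_mod p M'"
    using mat_mod_mult[OF X Mc, of p] mat_mod_mult[OF len_le_carrier[OF XM] len_le_carrier[OF M'(1)], of p]
    by (simp add: mult_SL)
  also have "\<dots> = mat_mod p X"
    using XS len_le_SL[OF M] by (simp add: M'(2) SL.m_assoc)
  finally show ?thesis
    using len_le_cong[OF len_le_mult[OF XM M'(1)] X] by (simp add: add.commute)
qed

lemma len_le_conj:
  assumes P: "len_le d P" and X: "len_le e X" and Y: "Y \<in> carrier_mat N N"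
    and eq: "Y * P = P * X"
  shows "len_le (2 * d + e) Y"
  using len_le_cancel_right[OF P _ Y, of "d + e"] len_le_mult[OF P X] eq
  by (simp add: mult_2 add.assoc)

lemma len_le_conj':
  assumes P: "len_le d P" and Y: "len_le e Y" and X: "X \<in> carrier_mat N N"
    and eq: "Y * P = P * X"
  shows "len_le (2 * d + e) X"
  using len_le_cancel_left[OF P _ X, of "e + d"] len_le_mult[OF Y P] eq
  by (simp add: mult_2 add_ac)

section \<open>Relations between elementary matrices\<close>

lemma elem_zero: "elem i j 0 = 1\<^sub>m N"
  by (intro eq_matI) auto

lemma elem_add:
  "i < N \<Longrightarrow> j < N \<Longrightarrow> i \<noteq> j \<Longrightarrow> elem i j s * elem i j t = elem i j (s + t)"
  by (subst elem_mult[of _ N], simp, simp) (intro eq_matI, auto)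

text \<open>This is Steinberg's commutator relation with the inverses moved to the other
  side.\<close>

lemma elem_commutator:
  assumes "i < N" "j < N" "k < N" "i \<noteq> j" "j \<noteq> k" "i \<noteq> k"
  shows "elem i j (s * t) * (elem k j t * elem i k s) = elem i k s * elem k j t"
proof -
  have "elem k j t * elem i k s = addrow t k j (elem i k s)" "elem i k s * elem k j t = addrow s i k (elem k j t)"
    using assms by (auto intro!: elem_mult)
  moreover have "elem i j (s * t) * addrow t k j (elem i k s) =
      addrow (s * t) i j (addrow t k j (elem i k s))"
    using assms by (intro elem_mult) auto
  ultimately show ?thesis using assms by (auto intro!: eq_matI simp: mult.commute)
qed

lemma len_le_elem_minus:
  assumes "len_le d (elem i j t)" "i < N" "j < N" "i \<noteq> j"
  shows "len_le d (elem i j (- t))"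
  using len_le_cancel_left[OF assms(1), of 0 "elem i j (- t)"] assms
  by (simp add: elem_add elem_zero len_le_one)

lemma len_le_elem_sign:
  assumes "len_le d (elem i j t)" "i < N" "j < N" "i \<noteq> j"
  shows "len_le d (elem i j ((-1) ^ k * t))"
  using assms len_le_elem_minus[OF assms] by (cases "even k") auto

lemma len_le_elem_commutator:
  assumes "len_le d (elem i k s)" "len_le e (elem k j t)"
    and "i < N" "j < N" "k < N" "i \<noteq> j" "j \<noteq> k" "i \<noteq> k"
  shows "len_le (2 * d + 2 * e) (elem i j (s * t))"
proof -
  have "len_le (e + d + (d + e)) (elem i j (s * t))"
    by (rule len_le_cancel_right[OF len_le_mult[OF assms(2,1)]])
      (use elem_commutator[OF assms(3-)] len_le_mult[OF assms(1,2)] in auto)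
  then show ?thesis by (simp add: mult_2 add_ac)
qed

lemma elem_mod:
  "i < N \<Longrightarrow> j < N \<Longrightarrow> mat_mod p (elem i j (t mod int p)) = mat_mod p (elem i j t)"
  by (rule mat_mod_eqI[of _ N N]) (auto simp: cong_def mod_add_left_eq)

subsection \<open>Elementary matrices with entry one\<close>

text \<open>One conjugation of \<open>matA N\<close> by \<open>matB N\<close> reaches the corner up
  to sign; passing to the inverse corrects the sign without extra length.\<close>

lemma len_le_elem_corner: "len_le 3 (elem (N - 1) 0 1)"
proof -
  let ?s = "(-1) ^ (N - 1) :: int"
  have "len_le (2 * 1 + 1) (elem (N - 1) 0 (?s * 1))"
    by (rule len_le_conj[OF len_le_matB _ _ elem_matB_row_wrap])
      (use N len_le_matA in \<open>auto simp: matA_elem\<close>)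
  then show ?thesis
    using len_le_elem_sign[of 3 "?s * 1" "N - 1" 0 "N - 1"] N by (simp add: sign_square)
qed

lemma len_le_matB_pow: "len_le k (matB N ^\<^sub>m k)"
proof (induction k)
  case 0
  then show ?case using len_le_one matB_carrier by simp
next
  case (Suc k)
  then show ?case using len_le_mult[OF Suc len_le_matB] by simp
qed

lemma matB_pow_carrier: "matB N ^\<^sub>m k \<in> carrier_mat N N"
  by (rule len_le_carrier[OF len_le_matB_pow])

lemma matB_pow_Suc: "matB N * matB N ^\<^sub>m k = matB N ^\<^sub>m (k + 1)"
proof (induction k)
  case 0
  then show ?case using matB_carrier by simp
next
  case (Suc k)
  then show ?case
    using assoc_mult_mat[OF matB_carrier matB_pow_carrier matB_carrier, of k] by simp
qed

text \<open>Iterated shifts carry \<open>matA N\<close> along the superdiagonal, so each factor of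
  the conjugator below can be traded for a single letter.\<close>

lemma matA_matB_pow:
  "k + 1 < N \<Longrightarrow> matA N * matB N ^\<^sub>m k = matB N ^\<^sub>m k * elem k (k + 1) 1"
proof (induction k)
  case 0
  then show ?case using matA_carrier matB_carrier by (simp add: matA_elem)
next
  case (Suc k)
  let ?B = "matB N ^\<^sub>m k"
  have "matA N * (?B * matB N) = (matA N * ?B) * matB N"
    by (rule assoc_mult_mat[symmetric, OF matA_carrier matB_pow_carrier matB_carrier])
  also have "\<dots> = ?B * (elem k (k + 1) 1 * matB N)"
    using Suc by (simp add: assoc_mult_mat[OF matB_pow_carrier _ matB_carrier])
  also have "\<dots> = (?B * matB N) * elem (k + 1) (k + 1 + 1) 1"
    using Suc.prems by (subst elem_matB) 
      (simp_all add: assoc_mult_mat[OF matB_pow_carrier matB_carrier addrow_mat_carrier])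
  finally show ?case by simp
qed

text \<open>For \<open>k > 0\<close> this is the product of the commuting matrices
  \<open>elem i 0 1\<close> with \<open>k \<le> i\<close>.\<close>

definition col_mat :: "nat \<Rightarrow> int mat" where
  "col_mat k = mat N N (\<lambda>(i, j). if i = j \<or> (j = 0 \<and> k \<le> i) then 1 else 0)"

lemma col_mat_carrier: "col_mat k \<in> carrier_mat N N"
  by (simp add: col_mat_def)

text \<open>Adding row \<open>k + 1\<close> to row \<open>k\<close> copies the 1 in column 0 one row
  up. As \<open>0 < k\<close>, the column operation on the other side adds only a unit
  vector.\<close>

lemma col_mat_elem:
  assumes "0 < k" "k + 1 < N"
  shows "col_mat k * elem k (k + 1) 1 = elem k (k + 1) 1 * col_mat (k + 1)"
  using assms
  by (subst elem_mult[OF col_mat_carrier], simp, subst mult_elem[OF col_mat_carrier], simp)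
    (intro eq_matI, auto simp: col_mat_def)

lemma col_mat_Suc:
  assumes "0 < k" "k < N"
  shows "elem k 0 1 * col_mat (k + 1) = col_mat k"
  using assms
  by (subst elem_mult[OF col_mat_carrier], simp) (intro eq_matI, auto simp: col_mat_def)

lemma col_mat_last: "col_mat (N - 1) = elem (N - 1) 0 1"
  using N by (intro eq_matI) (auto simp: col_mat_def)

text \<open>
  The conjugator is the product \<open>P\<^sub>k = E\<^bsub>k,k+1\<^esub> \<cdots> E\<^bsub>N-2,N-1\<^esub>\<close>. It is short because
  \<open>B\<^sup>k P\<^sub>k = A B\<^sup>k P\<^bsub>k+1\<^esub>\<close> telescopes.
\<close>
lemma col_mat_conjugator:
  assumes "m + 1 < N"
  shows "\<exists>P\<in>carrier_mat N N. len_le (N + 2 * m) (matB N ^\<^sub>m (N - 1 - m) * P) \<and>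
    col_mat (N - 1 - m) * P = P * elem (N - 1) 0 1"
  using assms
proof (induction m)
  case 0
  have "len_le N (matB N ^\<^sub>m (N - 1))" using len_le_mono[OF len_le_matB_pow] by simp
  then show ?case
    by (intro bexI[of _ "1\<^sub>m N"]) (auto simp: col_mat_last[simplified] right_mult_one_mat[OF matB_pow_carrier])
next
  case (Suc m)
  define k where "k = N - 1 - Suc m"
  have k: "N - 1 - m = k + 1" "0 < k" "k + 1 < N" using Suc.prems by (auto simp: k_def)
  let ?B = "matB N" and ?E = "elem k (k + 1) 1"
  have E: "?E \<in> carrier_mat N N" by simp
  obtain P where P: "P \<in> carrier_mat N N" "len_le (N + 2 * m) (?B ^\<^sub>m (k + 1) * P)"
    "col_mat (k + 1) * P = P * elem (N - 1) 0 1"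
    using Suc k by auto
  \<comment> \<open>Passing from \<open>k + 1\<close> to \<open>k\<close> costs one letter to remove
    a factor \<open>?B\<close> and one letter \<open>matA N\<close>, whence the
    \<open>2 * m\<close>.\<close>
  have "?B * (?B ^\<^sub>m k * P) = ?B ^\<^sub>m (k + 1) * P"
    by (simp only: assoc_mult_mat[symmetric, OF matB_carrier matB_pow_carrier P(1)] matB_pow_Suc)
  then have "len_le (1 + (N + 2 * m)) (?B ^\<^sub>m k * P)"
    using P by (intro len_le_cancel_left[OF len_le_matB])
      (auto intro: mult_carrier_mat[OF matB_pow_carrier])
  then have "len_le (N + 2 * Suc m) (matA N * (?B ^\<^sub>m k * P))"
    using len_le_mult[OF len_le_matA] by fastforce
  also have "matA N * (?B ^\<^sub>m k * P) = ?B ^\<^sub>m k * (?E * P)"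
    by (simp only: assoc_mult_mat[symmetric, OF matA_carrier matB_pow_carrier P(1)]
        assoc_mult_mat[symmetric, OF matB_pow_carrier E P(1)] matA_matB_pow[OF k(3)])
  finally have 1: "len_le (N + 2 * Suc m) (?B ^\<^sub>m k * (?E * P))" .
  have "col_mat k * (?E * P) = ?E * (col_mat (k + 1) * P)"
    by (simp only: assoc_mult_mat[symmetric, OF col_mat_carrier E P(1)]
        assoc_mult_mat[symmetric, OF E col_mat_carrier P(1)] col_mat_elem[OF k(2,3)])
  also have "\<dots> = (?E * P) * elem (N - 1) 0 1"
    using assoc_mult_mat[OF E P(1), of "elem (N - 1) 0 1" N] P(3) by simp
  finally have 2: "col_mat k * (?E * P) = (?E * P) * elem (N - 1) 0 1" .
  show ?case unfolding k_def[symmetric]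
    by (intro bexI[of _ "?E * P"] conjI 1 2 mult_carrier_mat[OF E P(1)])
qed

lemma len_le_col_mat:
  assumes "0 < k" "k < N"
  shows "len_le (7 * N) (col_mat k)"
proof -
  define m where "m = N - 1 - k"
  have k: "N - 1 - m = k" "m + 1 < N" using assms by (auto simp: m_def)
  obtain P where P: "P \<in> carrier_mat N N" "len_le (N + 2 * m) (matB N ^\<^sub>m k * P)"
    "col_mat k * P = P * elem (N - 1) 0 1"
    using col_mat_conjugator[OF k(2)] k by auto
  \<comment> \<open>With \<open>m = N - 1 - k\<close> this length is \<open>3 * N - 2 - k\<close>,
    so conjugating a word of length 3 stays below \<open>6 * N\<close>.\<close>
  have "len_le (k + (N + 2 * m)) P"
    by (rule len_le_cancel_left[OF len_le_matB_pow P(2,1)])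
  from len_le_conj[OF this len_le_elem_corner col_mat_carrier P(3)]
  show ?thesis by (rule len_le_mono) (use k N in auto)
qed

lemma len_le_elem_col0:
  assumes "0 < k" "k < N"
  shows "len_le (14 * N) (elem k 0 1)"
\<comment> \<open>In the last row \<open>col_mat k\<close> is already elementary; elsewhere the
  quotient of \<open>col_mat k\<close> by \<open>col_mat (k + 1)\<close> is taken.\<close>
proof (cases "k + 1 = N")
  case True
  then have "col_mat k = elem k 0 1" using col_mat_last by auto
  then show ?thesis using len_le_mono[OF len_le_col_mat[OF assms], of "14 * N"] by simp
next
  case False
  then show ?thesis
    using len_le_cancel_right[OF len_le_col_mat[of "k + 1"], of "7 * N" "elem k 0 1"]
      len_le_col_mat[OF assms] col_mat_Suc[OF assms] assms by simp
qed

text \<open>Column 0 is reached by walking back along the cyclic diagonal, two letters per shift. A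
  row wrap changes at most the sign, which inversion absorbs.\<close>

lemma len_le_elem_one_aux:
  "i < N \<Longrightarrow> j < N \<Longrightarrow> i \<noteq> j \<Longrightarrow> len_le (14 * N + 2 * j) (elem i j 1)"
proof (induction j arbitrary: i)
  case 0
  then show ?case using len_le_elem_col0 by simp
next
  case (Suc j)
  show ?case
  proof (cases i)
    case 0
    have "len_le (14 * N + 2 * j) (elem (N - 1) j ((-1) ^ (N - 1) * 1))"
      using Suc by (intro len_le_elem_sign) auto
    then have "len_le (2 * 1 + (14 * N + 2 * j)) (elem 0 (j + 1) 1)"
      by (rule len_le_conj'[OF len_le_matB _ _ elem_matB_row_wrap]) (use Suc in auto)
    then show ?thesis by (simp add: 0)
  next
    case i: (Suc i')
    have "len_le (2 * 1 + (14 * N + 2 * j)) (elem (i' + 1) (j + 1) 1)"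
      by (rule len_le_conj'[OF len_le_matB _ _ elem_matB]) (use Suc i in auto)
    then show ?thesis by (simp add: i)
  qed
qed

lemma len_le_elem_one:
  "i < N \<Longrightarrow> j < N \<Longrightarrow> i \<noteq> j \<Longrightarrow> len_le (16 * N) (elem i j 1)"
  by (rule len_le_mono[OF len_le_elem_one_aux]) auto

subsection \<open>Elementary matrices with arbitrary entry\<close>

text \<open>The vector \<open>(x, y)\<close> is placed in the top of column 2. These matrices form a
  copy of the additive group of integer pairs, on which the upper left 2 by 2 block acts linearly by
  conjugation.\<close>

definition trans_mat :: "int \<Rightarrow> int \<Rightarrow> int mat" where
  "trans_mat x y = elem 0 2 x * elem 1 2 y"

lemma trans_mat_addrow: "trans_mat x y = addrow x 0 2 (elem 1 2 y)"
  unfolding trans_mat_def using N by (intro elem_mult) auto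

lemma trans_mat_carrier: "trans_mat x y \<in> carrier_mat N N"
  by (simp add: trans_mat_addrow)

lemma trans_mat_index:
  "i < N \<Longrightarrow> j < N \<Longrightarrow> trans_mat x y $$ (i, j) =
    (if i = j then 1 else if j = 2 \<and> i = 0 then x else if j = 2 \<and> i = 1 then y else 0)"
  using N by (auto simp: trans_mat_addrow)

lemma trans_mat_add: "trans_mat x y * trans_mat x' y' = trans_mat (x + x') (y + y')"
proof -
  have "trans_mat x y * trans_mat x' y' = elem 0 2 x * (elem 1 2 y * trans_mat x' y')"
    unfolding trans_mat_def[of x y]
    by (rule assoc_mult_mat[OF addrow_mat_carrier addrow_mat_carrier trans_mat_carrier])
  also have "elem 1 2 y * trans_mat x' y' = addrow y 1 2 (trans_mat x' y')"
    using N by (intro elem_mult[OF trans_mat_carrier]) auto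
  also have "elem 0 2 x * \<dots> = addrow x 0 2 \<dots>"
    using N trans_mat_carrier by (intro elem_mult[of _ N]) auto
  also have "\<dots> = trans_mat (x + x') (y + y')"
    using N trans_mat_carrier[of x' y'] trans_mat_carrier[of "x + x'" "y + y'"]
    by (intro eq_matI) (auto simp: trans_mat_index)
  finally show ?thesis .
qed

lemma trans_mat_zero_right: "trans_mat x 0 = elem 0 2 x"
  by (simp add: trans_mat_def elem_zero)

lemma trans_mat_elem01: "elem 0 1 1 * trans_mat x y = trans_mat (x + y) y * elem 0 1 1"
proof -
  have "addrow 1 0 1 (trans_mat x y) = addcol 1 1 0 (trans_mat (x + y) y)"
    using N trans_mat_carrier[of x y] trans_mat_carrier[of "x + y" y]
    by (intro eq_matI) (auto simp: trans_mat_index)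
  then show ?thesis
    using N trans_mat_carrier by (simp add: elem_mult[of _ N] mult_elem[of _ N])
qed

lemma trans_mat_elem10: "elem 1 0 1 * trans_mat x y = trans_mat x (x + y) * elem 1 0 1"
proof -
  have "addrow 1 1 0 (trans_mat x y) = addcol 1 0 1 (trans_mat x (x + y))"
    using N trans_mat_carrier[of x y] trans_mat_carrier[of x "x + y"]
    by (intro eq_matI) (auto simp: trans_mat_index)
  then show ?thesis
    using N trans_mat_carrier by (simp add: elem_mult[of _ N] mult_elem[of _ N])
qed

text \<open>Its upper left block has rows \<open>(2, 1)\<close> and \<open>(1, 1)\<close>; the
  powers of this block consist of Fibonacci numbers.\<close>

definition hyp_mat :: "int mat" where
  "hyp_mat = elem 0 1 1 * elem 1 0 1"

lemma hyp_mat_carrier: "hyp_mat \<in> carrier_mat N N"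
  unfolding hyp_mat_def by (intro mult_carrier_mat) auto

lemma len_le_hyp_mat: "len_le (32 * N) hyp_mat"
  unfolding hyp_mat_def
  using len_le_mult[OF len_le_elem_one[of 0 1] len_le_elem_one[of 1 0]] N by simp

lemma hyp_mat_trans_mat: "hyp_mat * trans_mat x y = trans_mat (2 * x + y) (x + y) * hyp_mat"
proof -
  have E: "elem 0 1 1 \<in> carrier_mat N N" "elem 1 0 1 \<in> carrier_mat N N" by simp_all
  have "hyp_mat * trans_mat x y = elem 0 1 1 * (trans_mat x (x + y) * elem 1 0 1)"
    unfolding hyp_mat_def by (simp only: assoc_mult_mat[OF E trans_mat_carrier] trans_mat_elem10)
  also have "\<dots> = (trans_mat (x + (x + y)) (x + y) * elem 0 1 1) * elem 1 0 1"
    by (simp only: assoc_mult_mat[symmetric, OF E(1) trans_mat_carrier E(2)] trans_mat_elem01)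
  also have "\<dots> = trans_mat (x + (x + y)) (x + y) * hyp_mat"
    unfolding hyp_mat_def by (rule assoc_mult_mat[OF trans_mat_carrier E])
  also have "x + (x + y) = 2 * x + y" by simp
  finally show ?thesis .
qed

text \<open>
  Here \<open>H\<close> is a power of \<^const>\<open>hyp_mat\<close> and \<open>(g, f)\<close> is the second row of its upper left block.
  Since \<open>g\<close> becomes \<open>2 * g + f\<close> with \<open>f \<le> g\<close>, greedy expansion needs only the digits \<open>0, 1, 2\<close>.
\<close>
lemma greedy_expansion:
  "\<exists>H f g. len_le (64 * N * (k + 1)) H \<and> 0 \<le> f \<and> f \<le> g \<and> 2 ^ k \<le> g \<and>
     (\<forall>x y. \<exists>z. H * trans_mat x y = trans_mat z (g * x + f * y) * H) \<and>
     (\<forall>n. 0 \<le> n \<longrightarrow> n < g \<longrightarrow> (\<exists>z. len_le (64 * N * (k + 1)) (trans_mat z n * H)))"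
proof (induction k)
  case 0
  have len: "len_le (64 * N) hyp_mat" by (rule len_le_mono[OF len_le_hyp_mat]) simp
  \<comment> \<open>The second row of the block is \<open>(1, 1)\<close>, so
    \<open>f = g = 1\<close> and only \<open>n = 0\<close> has to be reached.\<close>
  have "trans_mat 0 0 * hyp_mat = hyp_mat"
    using hyp_mat_carrier by (simp add: trans_mat_zero_right elem_zero)
  then have "\<exists>z. len_le (64 * N) (trans_mat z n * hyp_mat)" if "0 \<le> n" "n < 1" for n
  proof -
    have "n = 0" using that by simp
    with len \<open>trans_mat 0 0 * hyp_mat = hyp_mat\<close>
    have "len_le (64 * N) (trans_mat 0 n * hyp_mat)" by simp
    then show ?thesis by blast
  qed
  moreover have "\<exists>z. hyp_mat * trans_mat x y = trans_mat z (1 * x + 1 * y) * hyp_mat" for x y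
    using hyp_mat_trans_mat[of x y] by auto
  ultimately show ?case
    using len by (intro exI[of _ hyp_mat] exI[of _ 1]) simp
next
  case (Suc k)
  let ?L = "64 * N * (k + 1)" and ?L' = "64 * N * (Suc k + 1)"
  obtain H f g where H: "len_le ?L H" and fg: "0 \<le> f" "f \<le> g" "2 ^ k \<le> g"
    and act: "\<And>x y. \<exists>z. H * trans_mat x y = trans_mat z (g * x + f * y) * H"
    and reach: "\<And>n. 0 \<le> n \<Longrightarrow> n < g \<Longrightarrow> \<exists>z. len_le ?L (trans_mat z n * H)"
    using Suc by blast
  have Hc: "H \<in> carrier_mat N N" using H by (rule len_le_carrier)
  note c = Hc hyp_mat_carrier trans_mat_carrier mult_carrier_mat
  let ?H = "H * hyp_mat"
  have "len_le ?L' ?H"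
    by (rule len_le_mono[OF len_le_mult[OF H len_le_hyp_mat]]) simp
  moreover have "\<exists>z. ?H * trans_mat x y = trans_mat z ((2 * g + f) * x + (g + f) * y) * ?H" for x y
  proof -
    obtain z where z: "H * trans_mat (2 * x + y) (x + y) =
        trans_mat z (g * (2 * x + y) + f * (x + y)) * H"
      using act by blast
    have "?H * trans_mat x y = H * (trans_mat (2 * x + y) (x + y) * hyp_mat)"
      by (simp only: assoc_mult_mat[OF c(1,2,3)] hyp_mat_trans_mat)
    also have "\<dots> = (trans_mat z (g * (2 * x + y) + f * (x + y)) * H) * hyp_mat"
      by (simp only: assoc_mult_mat[symmetric, OF c(1,3,2)] z)
    also have "\<dots> = trans_mat z (g * (2 * x + y) + f * (x + y)) * ?H"
      by (rule assoc_mult_mat[OF c(3,1,2)])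
    also have "g * (2 * x + y) + f * (x + y) = (2 * g + f) * x + (g + f) * y"
      by (simp add: algebra_simps)
    finally show ?thesis by blast
  qed
  moreover have "\<exists>z. len_le ?L' (trans_mat z n * ?H)" if n: "0 \<le> n" "n < 2 * g + f" for n
  proof -
    obtain x :: int where x: "x = 0 \<or> x = 1 \<or> x = 2" "0 \<le> n - g * x" "n - g * x < g"
    proof -
      consider "n < g" | "g \<le> n" "n < 2 * g" | "2 * g \<le> n" by linarith
      then show ?thesis by cases (use n fg that[of 0] that[of 1] that[of 2] in auto)
    qed
    obtain z where z: "len_le ?L (trans_mat z (n - g * x) * H)" using reach x by blast
    obtain z' where z': "H * trans_mat x 0 = trans_mat z' (g * x + f * 0) * H" using act by blast
    have len1: "len_le (16 * N) (elem 0 2 1)" using N by (intro len_le_elem_one) auto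
    have "elem 0 2 2 = elem 0 2 1 * elem 0 2 1" using N by (simp add: elem_add)
    then have "len_le (32 * N) (elem 0 2 x)"
      using x(1) len_le_mult[OF len1 len1] len_le_mono[OF len1, of "32 * N"]
        len_le_mono[OF len_le_one, of "32 * N"] by (auto simp: elem_zero)
    \<comment> \<open>A Horner step: moving \<open>trans_mat x 0\<close> left through
      \<open>H\<close> adds \<open>g * x\<close> to the second coordinate. The digit and
      \<open>hyp_mat\<close> cost \<open>32 * N\<close> each, which is the increment from
      \<open>?L\<close> to \<open>?L'\<close>.\<close>
    then have "len_le (?L + (32 * N + 32 * N))
        ((trans_mat z (n - g * x) * H) * (trans_mat x 0 * hyp_mat))"
      by (intro len_le_mult z len_le_hyp_mat) (simp add: trans_mat_zero_right)
    also have "(trans_mat z (n - g * x) * H) * (trans_mat x 0 * hyp_mat) =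
        trans_mat z (n - g * x) * ((H * trans_mat x 0) * hyp_mat)"
      by (simp only: assoc_mult_mat[OF c(1,3,2)]
          assoc_mult_mat[OF c(3,1) mult_carrier_mat[OF c(3,2)]])
    also have "\<dots> = trans_mat z (n - g * x) * (trans_mat z' (g * x) * ?H)"
      by (simp only: z' assoc_mult_mat[OF c(3,1,2)] mult_zero_right add_0_right)
    also have "\<dots> = trans_mat (z + z') n * ?H"
      using assoc_mult_mat[symmetric, OF c(3,3) mult_carrier_mat[OF c(1,2)]]
      by (simp add: trans_mat_add)
    finally show ?thesis by (intro exI[of _ "z + z'"]) (simp add: algebra_simps)
  qed
  ultimately show ?case
    using fg by (intro exI[of _ ?H] exI[of _ "g + f"] exI[of _ "2 * g + f"]) auto
qed

lemma len_le_elem02: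
  assumes k: "p \<le> 2 ^ k"
  shows "len_le (288 * N * (k + 1)) (elem 0 2 t)"
proof -
  let ?L = "64 * N * (k + 1)"
  obtain H f g where H: "len_le ?L H" and g: "2 ^ k \<le> g"
    and reach: "\<And>n. 0 \<le> n \<Longrightarrow> n < g \<Longrightarrow> \<exists>z. len_le ?L (trans_mat z n * H)"
    using greedy_expansion[of k] by blast
  define n where "n = t mod int p"
  have "int p \<le> 2 ^ k" using k by (metis of_nat_le_iff of_nat_numeral of_nat_power)
  moreover have "0 \<le> n" "n < int p" using prime_gt_0_nat[OF p] by (auto simp: n_def)
  ultimately have "0 \<le> n" "n < g" using g by linarith+
  then obtain z where z: "len_le ?L (trans_mat z n * H)" using reach by blast
  \<comment> \<open>The trailing \<open>H\<close> is itself short, so removing it only doubles the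
    bound.\<close>
  have u: "len_le (?L + ?L) (trans_mat z n)"
    by (rule len_le_cancel_right[OF H z trans_mat_carrier])
  have e: "len_le (16 * N) (elem 0 1 1)" using N by (intro len_le_elem_one) auto
  have E: "elem 0 2 n \<in> carrier_mat N N" "elem 0 1 1 \<in> carrier_mat N N" by simp_all
  have "elem 0 2 n * (trans_mat z n * elem 0 1 1) = (trans_mat n 0 * trans_mat z n) * elem 0 1 1"
    by (simp only: assoc_mult_mat[OF E(1) trans_mat_carrier E(2)] trans_mat_zero_right)
  also have "\<dots> = trans_mat (z + n) n * elem 0 1 1"
    by (simp add: trans_mat_add add.commute)
  also have "\<dots> = elem 0 1 1 * trans_mat z n"
    by (rule trans_mat_elem01[symmetric])
  finally have "elem 0 2 n * (trans_mat z n * elem 0 1 1) = elem 0 1 1 * trans_mat z n" .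
  \<comment> \<open>The total is \<open>256 * N * (k + 1) + 32 * N\<close>, at most
    \<open>288 * N * (k + 1)\<close>.\<close>
  then have "len_le (?L + ?L + 16 * N + (16 * N + (?L + ?L))) (elem 0 2 n)"
    using len_le_cancel_right[OF len_le_mult[OF u e], of "16 * N + (?L + ?L)" "elem 0 2 n"]
      len_le_mult[OF e u] by simp
  then have "len_le (288 * N * (k + 1)) (elem 0 2 n)"
    by (rule len_le_mono) (simp add: algebra_simps)
  then show ?thesis
    by (rule len_le_cong) (use N elem_mod[of 0 2 t] in \<open>auto simp: n_def\<close>)
qed

text \<open>Commutators with entries one move \<open>t\<close> from position \<open>(0, 2)\<close>
  first along row 0, then to any row outside column 0, and finally into column 0. Each roughly
  doubles the length, giving \<open>4\<close>, \<open>10\<close> and \<open>22\<close> times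
  \<open>?K\<close>, and \<open>22 * 288 = 6336\<close>.\<close>

lemma len_le_elem:
  assumes k: "p \<le> 2 ^ k" and ij: "i < N" "j < N" "i \<noteq> j"
  shows "len_le (6336 * N * (k + 1)) (elem i j t)"
proof -
  let ?K = "288 * N * (k + 1)"
  have K: "32 * N \<le> ?K" by simp
  have row0: "len_le (4 * ?K) (elem 0 j t)" if j: "j < N" "j \<noteq> 0" for j
  proof (cases "j = 2")
    case True
    then show ?thesis using len_le_mono[OF len_le_elem02[OF k]] by simp
  next
    case False
    have "len_le (2 * ?K + 2 * (16 * N)) (elem 0 j (t * 1))"
      by (rule len_le_elem_commutator[OF len_le_elem02[OF k] len_le_elem_one[of 2 j]])
        (use N j False in auto)
    from len_le_mono[OF this, of "4 * ?K"] show ?thesis by simp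
  qed
  have inner: "len_le (10 * ?K) (elem i j t)" if "i < N" "j < N" "i \<noteq> j" "j \<noteq> 0" for i j
  proof (cases "i = 0")
    case True
    then show ?thesis using that len_le_mono[OF row0] by simp
  next
    case False
    have "len_le (2 * (16 * N) + 2 * (4 * ?K)) (elem i j (1 * t))"
      by (rule len_le_elem_commutator[OF len_le_elem_one[of i 0] row0[of j]])
        (use N that False in auto)
    from len_le_mono[OF this, of "10 * ?K"] show ?thesis by simp
  qed
  have "len_le (22 * ?K) (elem i j t)"
  proof (cases "j = 0")
    case False
    then show ?thesis using ij len_le_mono[OF inner] by simp
  next
    case True
    \<comment> \<open>The intermediate index exists because \<open>3 \<le> N\<close>.\<close>
    obtain l where l: "l < N" "l \<noteq> i" "l \<noteq> 0"
      using N that[of 1] that[of 2] by (cases "i = 1") auto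
    have "len_le (2 * (10 * ?K) + 2 * (16 * N)) (elem i j (t * 1))"
      by (rule len_le_elem_commutator[OF inner[of i l] len_le_elem_one[of l j]])
        (use N ij l True in auto)
    from len_le_mono[OF this, of "22 * ?K"] show ?thesis by simp
  qed
  then show ?thesis by (simp add: mult.assoc)
qed

subsection \<open>Gaussian elimination\<close>

text \<open>This is the invariant of the elimination. Congruences instead of equalities let row
  operations be carried out over the integers.\<close>

definition reduced :: "nat \<Rightarrow> int mat \<Rightarrow> bool" where
  "reduced c M \<longleftrightarrow> M \<in> carrier_mat N N \<and> [det M = 1] (mod int p) \<and>
    (\<forall>i<N. \<forall>j<c. [M $$ (i, j) = (if i = j then 1 else 0)] (mod int p))"

lemma reducedD:
  assumes "reduced c M"
  shows "M \<in> carrier_mat N N" "[det M = 1] (mod int p)"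
    "\<And>i j. i < N \<Longrightarrow> j < c \<Longrightarrow> [M $$ (i, j) = (if i = j then 1 else 0)] (mod int p)"
  using assms unfolding reduced_def by auto

lemma elem_mult_index:
  assumes "M \<in> carrier_mat N N" "j < N" "a < N" "b < N"
  shows "(elem i j t * M) $$ (a, b) = (if a = i then t * M $$ (j, b) + M $$ (a, b) else M $$ (a, b))"
  using assms by (simp add: elem_mult[OF assms(1,2)])

text \<open>Row \<open>j\<close> vanishes modulo \<open>p\<close> in the finished columns because
  \<open>c \<le> j\<close>, so adding it to another row leaves them intact.\<close>

lemma reduced_elem_mult:
  assumes M: "reduced c M" and ij: "i < N" "j < N" "i \<noteq> j" "c \<le> j"
  shows "reduced c (elem i j t * M)"
  unfolding reduced_def
proof (intro conjI allI impI)
  note Mc = reducedD(1)[OF M]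
  show "elem i j t * M \<in> carrier_mat N N" by (rule mult_carrier_mat[OF _ Mc]) simp
  show "[det (elem i j t * M) = 1] (mod int p)"
    using ij reducedD(2)[OF M] by (simp add: det_mult[OF _ Mc] det_addrow_mat)
  fix a b assume ab: "a < N" "b < c"
  then have b: "b < N" "b \<noteq> j" using ij by auto
  have "[t * M $$ (j, b) + M $$ (a, b) = t * 0 + (if a = b then 1 else 0)] (mod int p)"
    using reducedD(3)[OF M ij(2) ab(2)] reducedD(3)[OF M ab] b
    by (intro cong_add cong_mult cong_refl) auto
  then show "[(elem i j t * M) $$ (a, b) = (if a = b then 1 else 0)] (mod int p)"
    using reducedD(3)[OF M ab] by (auto simp: elem_mult_index[OF Mc ij(2) ab(1) b(1)])
qed

lemma not_cong_1_0: "\<not> [1 = (0::int)] (mod int p)"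
  using prime_gt_1_nat[OF p] by (simp add: cong_def)

lemma sum_cong_single:
  fixes h :: "nat \<Rightarrow> int"
  assumes "j < N" "\<And>i. i < N \<Longrightarrow> i \<noteq> j \<Longrightarrow> [h i = 0] (mod m)"
  shows "[(\<Sum>i<N. h i) = h j] (mod m)"
proof -
  have "[(\<Sum>i<N. h i) = (\<Sum>i<N. if i = j then h j else 0)] (mod m)"
    using assms by (intro cong_sum) auto
  then show ?thesis using assms(1) by simp
qed

text \<open>
  Otherwise row \<open>c\<close> of the adjugate vanishes in the columns below \<open>c\<close>, where column \<open>c\<close> of the
  matrix may be nonzero, so the determinant vanishes.
\<close>
lemma reduced_pivot:
  assumes M: "reduced c M" and c: "c < N"
  shows "\<exists>i. c \<le> i \<and> i < N \<and> \<not> [M $$ (i, c) = 0] (mod int p)"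
proof (rule ccontr)
  assume "\<not> ?thesis"
  then have zero: "[M $$ (i, c) = 0] (mod int p)" if "c \<le> i" "i < N" for i
    using that by auto
  note Mc = reducedD(1)[OF M]
  let ?a = "adj_mat M"
  have a: "?a \<in> carrier_mat N N" "?a * M = det M \<cdot>\<^sub>m 1\<^sub>m N" using adj_mat[OF Mc] by auto
  have entry: "(\<Sum>i<N. ?a $$ (c, i) * M $$ (i, j)) = (if c = j then det M else 0)" if "j < N" for j
  proof -
    have "(?a * M) $$ (c, j) = (\<Sum>i<N. ?a $$ (c, i) * M $$ (i, j))"
      using a(1) Mc c that by (simp add: scalar_prod_def atLeast0LessThan)
    then show ?thesis using c that by (cases "c = j") (simp_all add: a(2))
  qed
  \<comment> \<open>Column \<open>j\<close> of \<open>M\<close> is a unit vector modulo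
    \<open>p\<close>, so the off-diagonal entry \<open>(c, j)\<close> of \<open>?a * M\<close>,
    which is 0, is congruent to the adjugate entry itself.\<close>
  have adj0: "[?a $$ (c, j) = 0] (mod int p)" if j: "j < c" for j
  proof -
    have "[(\<Sum>i<N. ?a $$ (c, i) * M $$ (i, j)) = ?a $$ (c, j) * M $$ (j, j)] (mod int p)"
    proof (rule sum_cong_single)
      fix i assume i: "i < N" "i \<noteq> j"
      have "[?a $$ (c, i) * M $$ (i, j) = ?a $$ (c, i) * 0] (mod int p)"
        using reducedD(3)[OF M i(1) j] i(2) by (intro cong_mult cong_refl) auto
      then show "[?a $$ (c, i) * M $$ (i, j) = 0] (mod int p)" by simp
    qed (use c j in simp)
    moreover have "[?a $$ (c, j) * M $$ (j, j) = ?a $$ (c, j) * 1] (mod int p)"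
      using reducedD(3)[OF M _ j, of j] c j by (intro cong_mult cong_refl) auto
    ultimately show ?thesis using entry[of j] c j by (auto simp: cong_def)
  qed
  have "[(\<Sum>i<N. ?a $$ (c, i) * M $$ (i, c)) = (\<Sum>i<N. 0)] (mod int p)"
  proof (rule cong_sum)
    fix i assume "i \<in> {..<N}"
    then have i: "i < N" by simp
    show "[?a $$ (c, i) * M $$ (i, c) = 0] (mod int p)"
    proof (cases "i < c")
      case True
      then show ?thesis using cong_mult[OF adj0[OF True] cong_refl[of "M $$ (i, c)"]] by simp
    next
      case False
      then show ?thesis using cong_mult[OF cong_refl[of "?a $$ (c, i)"] zero[OF _ i]] by simp
    qed
  qed
  then have "[det M = 0] (mod int p)" using entry[OF c] by simp
  then show False
    using reducedD(2)[OF M] not_cong_1_0 by (metis cong_sym cong_trans)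
qed

text \<open>In the last column there is no row below to correct the pivot. Modulo \<open>p\<close>
  the matrix is triangular with the other diagonal entries 1, so this entry is the
  determinant.\<close>

lemma reduced_last:
  assumes M: "reduced (N - 1) M"
  shows "[M $$ (N - 1, N - 1) = 1] (mod int p)"
proof -
  note Mc = reducedD(1)[OF M]
  let ?M = "mat_mod p M"
  have p1: "1 < int p" using prime_gt_1_nat[OF p] by simp
  have "upper_triangular ?M"
  proof (rule upper_triangularI)
    fix i j assume "j < i" "i < dim_row ?M"
    then have ij: "i < N" "j < N - 1" "i \<noteq> j" using Mc by auto
    then show "?M $$ (i, j) = 0"
      using reducedD(3)[OF M ij(1,2)] Mc by (simp add: mat_mod_index cong_def)
  qed
  then have "det ?M = prod_list (diag_mat ?M)"
    by (rule det_upper_triangular[of _ N]) (simp add: Mc)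
  also have "\<dots> = (\<Prod>i = 0..<N. ?M $$ (i, i))"
    using Mc by (simp add: prod_list_diag_prod)
  also have "\<dots> = (\<Prod>i\<in>{N - 1}. ?M $$ (i, i))"
  proof (rule prod.mono_neutral_right)
    show "\<forall>i\<in>{0..<N} - {N - 1}. ?M $$ (i, i) = 1"
    proof
      fix i assume "i \<in> {0..<N} - {N - 1}"
      then have i: "i < N" "i < N - 1" by auto
      then show "?M $$ (i, i) = 1"
        using reducedD(3)[OF M i] Mc p1 by (simp add: mat_mod_index cong_def)
    qed
  qed (use N in auto)
  also have "\<dots> = M $$ (N - 1, N - 1) mod int p" using Mc N by (simp add: mat_mod_index)
  finally have "[M $$ (N - 1, N - 1) = det M] (mod int p)"
    using det_mat_mod[OF Mc, of p] by (auto simp: cong_def)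
  then show ?thesis using reducedD(2)[OF M] by (rule cong_trans)
qed

lemma reduced_N:
  assumes M: "reduced N M"
  shows "len_le 0 M"
proof (rule len_le_cong[OF len_le_one reducedD(1)[OF M]])
  show "mat_mod p (1\<^sub>m N) = mat_mod p M"
    by (rule sym, rule mat_mod_eqI[of _ N N]) (use reducedD[OF M] in auto)
qed

section \<open>Counting row operations, each of length at most \<open>K\<close>\<close>

context
  fixes K :: nat
  assumes K: "\<And>i j t. i < N \<Longrightarrow> j < N \<Longrightarrow> i \<noteq> j \<Longrightarrow> len_le K (elem i j t)"
begin

lemma len_le_elem_mult:
  assumes "len_le e (elem i j t * M)" "M \<in> carrier_mat N N" "i < N" "j < N" "i \<noteq> j"
  shows "len_le (e + K) M"
  using len_le_cancel_left[OF K assms(1,2)] assms(3-) by (simp add: add.commute)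

text \<open>Rows from \<open>m\<close> on are already clear, apart from the pivot row; each
  remaining row costs one row operation. At \<open>m = 0\<close> the next column takes over through
  \<open>next_col\<close>.\<close>

lemma len_le_clear_column:
  assumes next_col: "\<And>M. reduced (c + 1) M \<Longrightarrow> len_le e M"
    and c: "c < N" and m: "m \<le> N" and M: "reduced c M"
    and pivot: "[M $$ (c, c) = 1] (mod int p)"
    and clear: "\<And>i. m \<le> i \<Longrightarrow> i < N \<Longrightarrow> i \<noteq> c \<Longrightarrow> [M $$ (i, c) = 0] (mod int p)"
  shows "len_le (e + m * K) M"
  using m M pivot clear
proof (induction m arbitrary: M)
  case 0
  have "reduced (c + 1) M"
    unfolding reduced_def
    using reducedD[OF "0.prems"(2)] "0.prems"(3,4) by (auto simp: less_Suc_eq)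
  then show ?case using next_col by simp
next
  case (Suc m)
  show ?case
  \<comment> \<open>The pivot row is skipped, and its share of the bound is left unspent.\<close>
  proof (cases "m = c")
    case True
    have "len_le (e + m * K) M"
      using Suc.prems True by (intro Suc.IH) (auto simp: Suc_le_eq)
    then show ?thesis by (rule len_le_mono) simp
  next
    case False
    have m: "m < N" using Suc.prems by simp
    note Mc = reducedD(1)[OF Suc.prems(2)]
    let ?M = "elem m c (- M $$ (m, c)) * M"
    have idx: "?M $$ (a, c) = (if a = m then - M $$ (m, c) * M $$ (c, c) + M $$ (a, c) else M $$ (a, c))"
      if "a < N" for a
      by (rule elem_mult_index[OF Mc c that c])
    have "len_le (e + m * K) ?M"
    proof (rule Suc.IH)
      show "reduced c ?M" by (rule reduced_elem_mult) (use Suc.prems c m False in auto)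
      show "[?M $$ (c, c) = 1] (mod int p)" using Suc.prems(3) idx[OF c] False by simp
      fix i assume i: "m \<le> i" "i < N" "i \<noteq> c"
      show "[?M $$ (i, c) = 0] (mod int p)"
      proof (cases "i = m")
        case True
        have "[- M $$ (m, c) * M $$ (c, c) + M $$ (m, c) = - M $$ (m, c) * 1 + M $$ (m, c)] (mod int p)"
          by (intro cong_add cong_mult cong_refl Suc.prems(3))
        then show ?thesis using idx[OF i(2)] True by simp
      next
        case False
        then show ?thesis using idx[OF i(2)] Suc.prems(4)[of i] i by simp
      qed
    qed (use m in simp)
    then have "len_le (e + m * K + K) M"
      by (rule len_le_elem_mult) (use Mc c m False in auto)
    then show ?thesis by (simp add: add_ac)
  qed
qed

text \<open>Clearing takes at most \<open>N\<close> operations, and at most two more make the pivot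
  1: a nonzero entry below it can be scaled to correct it, and such an entry can be created by
  copying the pivot down.\<close>

lemma len_le_column:
  assumes next_col: "\<And>M. reduced (c + 1) M \<Longrightarrow> len_le e M"
    and c: "c < N" and M: "reduced c M"
  shows "len_le (e + (N + 2) * K) M"
proof -
  note Mc = reducedD(1)[OF M]
  have clear: "len_le (e + N * K) X" if "reduced c X" "[X $$ (c, c) = 1] (mod int p)" for X
    by (rule len_le_clear_column[OF next_col c]) (use that in auto)
  have below: "len_le (e + N * K + K) X"
    if X: "reduced c X" and i: "c < i" "i < N" "\<not> [X $$ (i, c) = 0] (mod int p)" for X i
  proof -
    note Xc = reducedD(1)[OF X]
    have "coprime (X $$ (i, c)) (int p)"
      using i(3) p prime_imp_coprime[of "int p" "X $$ (i, c)"]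
      by (simp add: cong_0_iff coprime_commute)
    then obtain y where y: "[X $$ (i, c) * y = 1] (mod int p)"
      using cong_solve_coprime_int by blast
    \<comment> \<open>As \<open>y\<close> inverts \<open>X $$ (i, c)\<close> modulo
      \<open>p\<close>, adding \<open>?t\<close> times row \<open>i\<close> turns the pivot into
      1.\<close>
    let ?t = "(1 - X $$ (c, c)) * y"
    have "[(1 - X $$ (c, c)) * (X $$ (i, c) * y) + X $$ (c, c) = (1 - X $$ (c, c)) * 1 + X $$ (c, c)] (mod int p)"
      by (intro cong_add cong_mult cong_refl y)
    then have "[(elem c i ?t * X) $$ (c, c) = 1] (mod int p)"
      by (simp add: elem_mult_index[OF Xc i(2) c c] mult_ac)
    then have "len_le (e + N * K) (elem c i ?t * X)"
      using X c i by (intro clear reduced_elem_mult) auto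
    then show ?thesis by (rule len_le_elem_mult) (use Xc c i in auto)
  qed
  obtain i where i: "c \<le> i" "i < N" "\<not> [M $$ (i, c) = 0] (mod int p)"
    using reduced_pivot[OF M c] by blast
  consider "c = N - 1" | "c < i" | "c + 1 < N" "i = c" "[M $$ (c + 1, c) = 0] (mod int p)"
    | "c + 1 < N" "\<not> [M $$ (c + 1, c) = 0] (mod int p)"
    using i c by linarith
  then show ?thesis
  proof cases
    case 1
    then have "[M $$ (c, c) = 1] (mod int p)" using reduced_last M by simp
    from clear[OF M this] show ?thesis by (rule len_le_mono) simp
  next
    case 2
    from below[OF M 2 i(2,3)] show ?thesis by (rule len_le_mono) simp
  next
    case 3
    let ?M = "elem (c + 1) c 1 * M"
    have "[1 * M $$ (c, c) + M $$ (c + 1, c) = 1 * M $$ (c, c) + 0] (mod int p)"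
      by (intro cong_add cong_mult cong_refl 3)
    then have "[?M $$ (c + 1, c) = M $$ (c, c)] (mod int p)"
      using 3(1) c by (simp add: elem_mult_index[OF Mc c])
    then have "\<not> [?M $$ (c + 1, c) = 0] (mod int p)"
      using i(3) 3(2) by (metis cong_sym cong_trans)
    then have "len_le (e + N * K + K) ?M"
      using 3 c by (intro below reduced_elem_mult M) auto
    then have "len_le (e + N * K + K + K) M"
      by (rule len_le_elem_mult) (use Mc c 3 in auto)
    then show ?thesis by (rule len_le_mono) simp
  next
    case 4
    from below[OF M _ 4] show ?thesis by (auto elim: len_le_mono)
  qed
qed

lemma len_le_reduced:
  "m \<le> N \<Longrightarrow> reduced (N - m) M \<Longrightarrow> len_le (m * ((N + 2) * K)) M"
proof (induction m arbitrary: M)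
  case 0
  then show ?case using reduced_N by simp
next
  case (Suc m)
  have "len_le (m * ((N + 2) * K) + (N + 2) * K) M"
    by (rule len_le_column[of "N - Suc m"]) (use Suc in \<open>auto simp: Suc_diff_Suc\<close>)
  then show ?case by (simp add: add.commute)
qed

end

section \<open>The bound on the diameter\<close>

lemma len_le_SL_element:
  assumes k: "p \<le> 2 ^ k" and M: "M \<in> carrier (SL N p)"
  shows "len_le (N * ((N + 2) * (6336 * N * (k + 1)))) M"
proof -
  have "reduced (N - N) M" using M by (simp add: reduced_def carrier_SL[OF p])
  then show ?thesis
    by (intro len_le_reduced[OF _ order_refl]) (auto intro: len_le_elem[OF k, simplified])
qed

lemma diam_Cay_le:
  assumes k: "p \<le> 2 ^ k"
  shows "diam_Cay (SL N p) gens \<le> enat (N * ((N + 2) * (6336 * N * (k + 1))))"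
  unfolding diam_Cay_def
proof (rule Inf_lower, rule CollectI, rule exI, rule conjI, rule refl, rule ballI)
  fix g assume g: "g \<in> carrier (SL N p)"
  then have "mat_mod p g = g" by (simp add: carrier_SL[OF p])
  with len_le_SL_element[OF k g]
  show "\<exists>w. set w \<subseteq> gens \<union> m_inv (SL N p) ` gens \<and>
      length w \<le> N * ((N + 2) * (6336 * N * (k + 1))) \<and> word_value (SL N p) w = g"
    unfolding len_le_def by simp
qed

end

theorem corollary1p1:
  "\<exists>C::real. C > 0 \<and> (\<forall>(N::nat) (p::nat). N \<ge> 3 \<longrightarrow> prime p \<longrightarrow>
     ereal_of_enat (diam_Cay (SL N p) {mat_mod p (matA N), mat_mod p (matB N)})
       \<le> ereal (C * real N ^ 3 * ln (real p)))"
proof (intro exI[of _ "38016 / ln 2"] conjI allI impI)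
  fix N p :: nat assume N: "3 \<le> N" and p: "prime p"
  interpret sl_words N p using N p by unfold_locales
  \<comment> \<open>Rounding up gives \<open>p \<le> 2 ^ k\<close> and loses at most 1 against the
    logarithm.\<close>
  define k where "k = nat \<lceil>log 2 p\<rceil>"
  have p2: "2 \<le> real p" using prime_ge_2_nat[OF p] by simp
  then have log1: "1 \<le> log 2 p" by (simp add: le_log_iff)
  have k: "log 2 p \<le> k" "k \<le> log 2 p + 1" using log1 by (auto simp: k_def)
  have "real p \<le> 2 powr k" using k(1) p2 by (simp add: log_le_iff)
  then have "real p \<le> real (2 ^ k)" by (simp add: powr_realpow)
  then have pk: "p \<le> 2 ^ k" by (simp only: of_nat_le_iff)
  have "real (N * ((N + 2) * (6336 * N * (k + 1)))) = 6336 * real N ^ 2 * (real (N + 2) * real (k + 1))"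
    by (simp add: power2_eq_square algebra_simps)
  \<comment> \<open>Here \<open>N + 2 \<le> 2 * N\<close>, and
    \<open>k + 1 \<le> log 2 p + 2 \<le> 3 * log 2 p\<close> since \<open>1 \<le> log 2 p\<close>.
    The constant is \<open>6336 * 2 * 3 = 38016\<close>, divided by \<open>ln 2\<close> for the
    change of base.\<close>
  also have "\<dots> \<le> 6336 * real N ^ 2 * ((2 * real N) * (3 * log 2 p))"
    using N k log1 by (intro mult_left_mono mult_mono) auto
  also have "\<dots> = 38016 / ln 2 * real N ^ 3 * ln (real p)"
    by (simp add: log_def power3_eq_cube power2_eq_square)
  finally have "ereal (real (N * ((N + 2) * (6336 * N * (k + 1))))) \<le>
    ereal (38016 / ln 2 * real N ^ 3 * ln (real p))" by simp
  moreover have "ereal_of_enat (diam_Cay (SL N p) gens) \<le>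
      ereal_of_enat (enat (N * ((N + 2) * (6336 * N * (k + 1)))))"
    using diam_Cay_le[OF pk] by (simp only: ereal_of_enat_le_iff)
  ultimately show "ereal_of_enat (diam_Cay (SL N p) gens) \<le>
      ereal (38016 / ln 2 * real N ^ 3 * ln (real p))"
    by (simp only: ereal_of_enat_simps)
qed simp

end
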